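(* Let $\alpha\in[2,3]$ be the fixed energy exponent. The deadline game with the proportional cost sharing mechanism does not always admit a pure Nash equilibrium; that is, there exist a number of players $n$ and job parameters $(w_i,r_i,p_i)_{i=1}^n$ for which no strategy profile $d$ is a pure Nash equilibrium of the game with proportional cost sharing.
   Context: Speed scaling model. A single machine can run at any speed $s(t)\ge 0$ at time $t$; in a time interval $I$ it executes workload $\int_I s(t)\,dt$ and consumes energy $\int_I s(t)^\alpha\,dt$, where $\alpha\in[2,3]$ is a fixed constant. There are $n$ jobs; job $i$ has workload $w_i>0$, release time $r_i$ and deadline $d_i>r_i$. A (preemptive) schedule specifies a speed function and, at each time, at most one job being processed at that speed; it is feasible if each job $i$ receives total workload $w_i$, all of it within $[r_i,d_i]$. $\mathrm{OPT}(d)$ denotes the feasible schedule of minimum energy for deadlines $d=(d_1,\dots,d_n)$; its speed function is piecewise constant, and jobs are executed in preemptive earliest-deadline-first order (at every time, among released and uncompleted jobs, the one with the smallest deadline is executed, ties broken by job index). In $\mathrm{OPT}(d)$ each job is executed at constant speed. The game. Player $i$ owns job $i$ and has a priority weight $p_i>0$. The strategy of player $i$ is the choice of a deadline $d_i>r_i$. The penalty of player $i$, which he wants to minimize, is $p_i d_i + b_i(w,r,d)$, where $b_i$ is the energy cost share. In proportional cost sharing, $b_i(w,r,d)$ is the energy consumed in $\mathrm{OPT}(d)$ during the execution of job $i$ (equal to $s^{\alpha-1}w_i$ if job $i$ is executed at constant speed $s$). A strategy profile $d$ is a pure Nash equilibrium if no player can strictly decrease his penalty by unilaterally changing his deadline.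 *)

theory Defs
  imports "HOL-Analysis.Analysis"
begin

text \<open>Jobs (and players) are the numbers \<open>i < n\<close>. A schedule gives the machine speed at each time and
  the job processed at that speed, if any. Workloads and energies are extended nonnegative integrals,
  so that schedules of infinite energy are also covered.\<close>

record schedule =
  speed :: "real \<Rightarrow> real"
  job :: "real \<Rightarrow> nat option"

definition workload :: "schedule \<Rightarrow> nat \<Rightarrow> real set \<Rightarrow> ennreal" where
  "workload S i T = (\<integral>\<^sup>+ t \<in> T \<inter> {t. job S t = Some i}. ennreal (speed S t) \<partial>lborel)"

definition energy :: "real \<Rightarrow> schedule \<Rightarrow> real set \<Rightarrow> ennreal" where
  "energy \<alpha> S T = (\<integral>\<^sup>+ t \<in> T. ennreal (speed S t powr \<alpha>) \<partial>lborel)"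

definition schedule_for :: "nat \<Rightarrow> schedule \<Rightarrow> bool" where
  "schedule_for n S \<longleftrightarrow>
     speed S \<in> borel_measurable borel \<and> (\<forall>t. 0 \<le> speed S t) \<and>
     job S \<in> measurable borel (count_space UNIV) \<and> (\<forall>t i. job S t = Some i \<longrightarrow> i < n)"

definition feasible ::
  "nat \<Rightarrow> (nat \<Rightarrow> real) \<Rightarrow> (nat \<Rightarrow> real) \<Rightarrow> (nat \<Rightarrow> real) \<Rightarrow> schedule \<Rightarrow> bool" where
  "feasible n w r d S \<longleftrightarrow> schedule_for n S \<and>
     (\<forall>i<n. workload S i UNIV = ennreal (w i) \<and> workload S i {r i..d i} = ennreal (w i))"

definition pending :: "nat \<Rightarrow> (nat \<Rightarrow> real) \<Rightarrow> (nat \<Rightarrow> real) \<Rightarrow> schedule \<Rightarrow> real \<Rightarrow> nat set" where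
  "pending n w r S t = {i. i < n \<and> r i \<le> t \<and> workload S i {..t} < ennreal (w i)}"

text \<open>Preemptive earliest deadline first, ties broken by index. The equivalence also forces
  the machine to process no job exactly when none is pending.\<close>

definition edf :: "nat \<Rightarrow> (nat \<Rightarrow> real) \<Rightarrow> (nat \<Rightarrow> real) \<Rightarrow> (nat \<Rightarrow> real) \<Rightarrow> schedule \<Rightarrow> bool" where
  "edf n w r d S \<longleftrightarrow>
     (\<forall>t i. job S t = Some i \<longleftrightarrow>
        i \<in> pending n w r S t \<and>
        (\<forall>j \<in> pending n w r S t. d i < d j \<or> (d i = d j \<and> i \<le> j)))"

definition is_OPT ::
  "real \<Rightarrow> nat \<Rightarrow> (nat \<Rightarrow> real) \<Rightarrow> (nat \<Rightarrow> real) \<Rightarrow> (nat \<Rightarrow> real) \<Rightarrow> schedule \<Rightarrow> bool" where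
  "is_OPT \<alpha> n w r d S \<longleftrightarrow> feasible n w r d S \<and>
     (\<forall>S'. feasible n w r d S' \<longrightarrow> energy \<alpha> S UNIV \<le> energy \<alpha> S' UNIV) \<and>
     edf n w r d S"

text \<open>For \<open>\<alpha> > 1\<close>, strict convexity determines the optimal speed function up to a null set, and with it
  the EDF assignment and all cost shares; the choice below only fixes a representative. That the
  optimal speed is almost everywhere piecewise constant, and constant on each job, is a consequence
  of optimality and is not imposed.\<close>

definition OPT ::
  "real \<Rightarrow> nat \<Rightarrow> (nat \<Rightarrow> real) \<Rightarrow> (nat \<Rightarrow> real) \<Rightarrow> (nat \<Rightarrow> real) \<Rightarrow> schedule" where
  "OPT \<alpha> n w r d = (SOME S. is_OPT \<alpha> n w r d S)"

text \<open>The energy below is finite for an optimal schedule whenever \<open>r i < d i\<close> for all jobs.\<close>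

definition prop_share ::
  "real \<Rightarrow> nat \<Rightarrow> (nat \<Rightarrow> real) \<Rightarrow> (nat \<Rightarrow> real) \<Rightarrow> (nat \<Rightarrow> real) \<Rightarrow> nat \<Rightarrow> real" where
  "prop_share \<alpha> n w r d i =
     (let S = OPT \<alpha> n w r d in enn2real (energy \<alpha> S {t. job S t = Some i}))"

definition penalty ::
  "real \<Rightarrow> nat \<Rightarrow> (nat \<Rightarrow> real) \<Rightarrow> (nat \<Rightarrow> real) \<Rightarrow> (nat \<Rightarrow> real) \<Rightarrow> (nat \<Rightarrow> real) \<Rightarrow> nat \<Rightarrow> real" where
  "penalty \<alpha> n w r p d i = p i * d i + prop_share \<alpha> n w r d i"

text \<open>Only the values of \<open>d\<close> on \<open>{..<n}\<close> matter.\<close>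

definition pure_Nash ::
  "real \<Rightarrow> nat \<Rightarrow> (nat \<Rightarrow> real) \<Rightarrow> (nat \<Rightarrow> real) \<Rightarrow> (nat \<Rightarrow> real) \<Rightarrow> (nat \<Rightarrow> real) \<Rightarrow> bool" where
  "pure_Nash \<alpha> n w r p d \<longleftrightarrow>
     (\<forall>i<n. r i < d i) \<and>
     (\<forall>i<n. \<forall>x. r i < x \<longrightarrow> \<not> penalty \<alpha> n w r p (d(i := x)) i < penalty \<alpha> n w r p d i)"

end

theory Submission
  imports Defs
begin

text \<open>Two identical jobs already have no equilibrium. If \<open>a\<close> has the smaller deadline, the optimal
  schedule runs \<open>a\<close> until \<open>\<tau> = min (d a) (d b / 2)\<close> and then \<open>b\<close> until \<open>d b\<close>; optimality and
  almost-everywhere uniqueness come from the strict tangent inequality for \<open>x powr \<alpha>\<close>.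
  In an equilibrium \<open>d b \<ge> 2 * d a\<close>, since otherwise \<open>a\<close> announces \<open>d b / 2\<close> at the same cost share.
  If \<open>d b > 2 * d a\<close>, each player has a processing interval to himself and chooses the same optimal
  length for it, which gives \<open>d b = 2 * d a\<close> after all. At \<open>d b = 2 * d a\<close> the penalty of \<open>b\<close> has a concave kink: lowering
  \<open>d b\<close> speeds up both jobs, and \<open>b\<close> pays only for half of this.\<close>

section \<open>Strict convexity of the power function\<close>

text \<open>The function \<open>?h\<close> has a derivative with the sign of \<open>u - y\<close>,
  so on positive arguments \<open>y\<close> is its strict minimum. The cases \<open>x = 0\<close>
  and \<open>y = 0\<close> are separate because the derivative is computed for \<open>0 < u\<close>
  only.\<close>

lemma powr_tangent_strict:
  fixes x y \<alpha> :: real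
  assumes "1 < \<alpha>" "0 \<le> x" "0 \<le> y" "x \<noteq> y"
  shows "\<alpha> * y powr (\<alpha> - 1) * x < x powr \<alpha> + (\<alpha> - 1) * y powr \<alpha>"
proof (cases "y = 0")
  case True
  with assms show ?thesis by simp
next
  case False
  then have y: "0 < y" using assms by simp
  show ?thesis
  proof (cases "x = 0")
    case True
    with assms y show ?thesis by simp
  next
    case False
    then have x: "0 < x" using assms by simp
    let ?h = "\<lambda>u. u powr \<alpha> - \<alpha> * y powr (\<alpha> - 1) * u"
    have der: "(?h has_real_derivative (\<alpha> * (u powr (\<alpha> - 1) - y powr (\<alpha> - 1)))) (at u)"
      if "0 < u" for u
      using that by (auto intro!: derivative_eq_intros simp: algebra_simps)
    have hy: "?h y = - ((\<alpha> - 1) * y powr \<alpha>)"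
      using y by (simp add: powr_diff algebra_simps)
    have "?h y < ?h x"
    proof (cases "x < y")
      case True
      obtain z where z: "x < z" "z < y"
        "?h y - ?h x = (y - x) * (\<alpha> * (z powr (\<alpha> - 1) - y powr (\<alpha> - 1)))"
        using MVT2[of x y ?h "\<lambda>u. \<alpha> * (u powr (\<alpha> - 1) - y powr (\<alpha> - 1))"] True der x
        by force
      have "z powr (\<alpha> - 1) < y powr (\<alpha> - 1)"
        using z x assms by (intro powr_less_mono2) auto
      then have "(y - x) * (\<alpha> * (z powr (\<alpha> - 1) - y powr (\<alpha> - 1))) < 0"
        using True assms by (intro mult_pos_neg) auto
      then show ?thesis using z(3) by linarith
    next
      case False
      then have xy: "y < x" using assms by simp
      obtain z where z: "y < z" "z < x"
        "?h x - ?h y = (x - y) * (\<alpha> * (z powr (\<alpha> - 1) - y powr (\<alpha> - 1)))"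
        using MVT2[of y x ?h "\<lambda>u. \<alpha> * (u powr (\<alpha> - 1) - y powr (\<alpha> - 1))"] xy der y
        by force
      have "y powr (\<alpha> - 1) < z powr (\<alpha> - 1)"
        using z y assms by (intro powr_less_mono2) auto
      then have "0 < (x - y) * (\<alpha> * (z powr (\<alpha> - 1) - y powr (\<alpha> - 1)))"
        using xy assms by (intro mult_pos_pos) auto
      then show ?thesis using z(3) by linarith
    qed
    then show ?thesis using hy by linarith
  qed
qed

lemma powr_tangent:
  fixes x y \<alpha> :: real
  assumes "1 < \<alpha>" "0 \<le> x" "0 \<le> y"
  shows "\<alpha> * y powr (\<alpha> - 1) * x \<le> x powr \<alpha> + (\<alpha> - 1) * y powr \<alpha>"
proof (cases "x = y")
  case True
  have "y powr (\<alpha> - 1) * y = y powr \<alpha>"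
    using assms by (cases "y = 0") (auto simp: powr_diff)
  with True show ?thesis by (simp add: algebra_simps)
qed (use powr_tangent_strict[OF assms] in auto)

lemma mono_workload: "T \<subseteq> T' \<Longrightarrow> workload S i T \<le> workload S i T'"
  unfolding workload_def by (intro nn_integral_mono) (auto simp: indicator_def)

text \<open>Splits the EDF equivalence, which quantifies over all jobs, into one condition per
  job.\<close>

lemma eq_Some_iff_two:
  assumes "b \<noteq> a"
  shows "(\<forall>i. J = Some i \<longleftrightarrow> i = a \<and> P \<or> i = b \<and> Q) \<longleftrightarrow>
    (J = Some a \<longleftrightarrow> P) \<and> (J = Some b \<longleftrightarrow> Q) \<and> (\<forall>i. J = Some i \<longrightarrow> i = a \<or> i = b)"
  using assms by (cases J) auto

section \<open>The candidate optimal schedule for two unit jobs released at time 0\<close>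

text \<open>Naming the jobs by their EDF order, tie-break included, treats both labellings at
  once.\<close>

locale two_jobs =
  fixes \<alpha> :: real and a b :: nat and d :: "nat \<Rightarrow> real"
  assumes exponent: "1 < \<alpha>"
    and jobs: "{..<2} = {a, b}" "a \<noteq> b"
    and first_pos: "0 < d a"
    and first: "d a < d b \<or> d a = d b \<and> a < b"
begin

text \<open>Completion time of \<open>a\<close>. If \<open>2 * d a \<le> d b\<close>, then
  \<open>a\<close> fills the critical interval up to \<open>d a\<close>; otherwise both jobs run at
  the common speed \<open>2 / d b\<close>.\<close>

definition \<tau> :: real where "\<tau> = min (d a) (d b / 2)"

definition opt_speed :: "real \<Rightarrow> real" where
  "opt_speed t = (if 0 \<le> t \<and> t < \<tau> then 1 / \<tau> else if \<tau> \<le> t \<and> t < d b then 1 / (d b - \<tau>) else 0)"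

text \<open>Half-open intervals are forced: \<open>edf\<close> is demanded at every instant, and
  \<open>pending\<close> counts the work up to and including \<open>t\<close>, so a job is no longer
  pending at its completion time.\<close>

definition opt_job :: "real \<Rightarrow> nat option" where
  "opt_job t = (if 0 \<le> t \<and> t < \<tau> then Some a else if \<tau> \<le> t \<and> t < d b then Some b else None)"

definition opt_schedule :: schedule where
  "opt_schedule = \<lparr>speed = opt_speed, job = opt_job\<rparr>"

definition opt_energy :: real where
  "opt_energy = \<tau> powr (1 - \<alpha>) + (d b - \<tau>) powr (1 - \<alpha>)"

lemma \<tau>: "0 < \<tau>" "\<tau> \<le> d a" "2 * \<tau> \<le> d b" "\<tau> < d b" "\<tau> = d a \<or> 2 * \<tau> = d b"
  using first first_pos unfolding \<tau>_def by auto

lemma less_two_iff: "i < 2 \<longleftrightarrow> i = a \<or> i = b"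
  using jobs(1) by (metis insert_iff lessThan_iff singletonD)

lemma ab: "a < 2" "b < 2" "b \<noteq> a"
  using less_two_iff jobs(2) by auto

lemma opt_speed_measurable [measurable]: "opt_speed \<in> borel_measurable borel"
  unfolding opt_speed_def[abs_def] by measurable

lemma opt_job_measurable [measurable]: "opt_job \<in> measurable borel (count_space UNIV)"
  unfolding opt_job_def[abs_def] by measurable

lemma opt_speed_nonneg: "0 \<le> opt_speed t"
  unfolding opt_speed_def using \<tau> by auto

lemma integral_opt_speed_first:
  assumes "0 \<le> x" "x \<le> \<tau>"
  shows "(\<integral>\<^sup>+t\<in>{0..<x}. ennreal (opt_speed t) \<partial>lborel) = ennreal (x / \<tau>)"
proof -
  have "(\<integral>\<^sup>+t\<in>{0..<x}. ennreal (opt_speed t) \<partial>lborel)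
      = (\<integral>\<^sup>+t. ennreal (1 / \<tau>) * indicator {0..<x} t \<partial>lborel)"
    using assms by (intro nn_integral_cong) (auto simp: opt_speed_def indicator_def)
  also have "\<dots> = ennreal (x / \<tau>)"
    using assms \<tau> by (simp add: nn_integral_cmult_indicator ennreal_mult[symmetric])
  finally show ?thesis .
qed

lemma integral_opt_speed_second:
  assumes "\<tau> \<le> x" "x \<le> d b"
  shows "(\<integral>\<^sup>+t\<in>{\<tau>..<x}. ennreal (opt_speed t) \<partial>lborel) = ennreal ((x - \<tau>) / (d b - \<tau>))"
proof -
  have "(\<integral>\<^sup>+t\<in>{\<tau>..<x}. ennreal (opt_speed t) \<partial>lborel)
      = (\<integral>\<^sup>+t. ennreal (1 / (d b - \<tau>)) * indicator {\<tau>..<x} t \<partial>lborel)"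
    using assms by (intro nn_integral_cong) (auto simp: opt_speed_def indicator_def)
  also have "\<dots> = ennreal ((x - \<tau>) / (d b - \<tau>))"
    using assms \<tau> by (simp add: nn_integral_cmult_indicator ennreal_mult[symmetric])
  finally show ?thesis .
qed

text \<open>For unit work spread evenly over length \<open>x\<close>, the energy and the marginal
  price of work (without its factor \<alpha>) coincide.\<close>

lemma inverse_powr_times:
  assumes "0 < (x::real)"
  shows "(1 / x) powr \<alpha> * x = x powr (1 - \<alpha>)" "(1 / x) powr (\<alpha> - 1) = x powr (1 - \<alpha>)"
  using assms by (simp_all add: powr_divide powr_diff)

lemma energy_first:
  "(\<integral>\<^sup>+t\<in>{0..<\<tau>}. ennreal (opt_speed t powr \<alpha>) \<partial>lborel) = ennreal (\<tau> powr (1 - \<alpha>))"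
proof -
  have "(\<integral>\<^sup>+t\<in>{0..<\<tau>}. ennreal (opt_speed t powr \<alpha>) \<partial>lborel)
      = (\<integral>\<^sup>+t. ennreal ((1 / \<tau>) powr \<alpha>) * indicator {0..<\<tau>} t \<partial>lborel)"
    by (intro nn_integral_cong) (auto simp: opt_speed_def indicator_def)
  also have "\<dots> = ennreal ((1 / \<tau>) powr \<alpha> * \<tau>)"
    using \<tau> by (simp add: nn_integral_cmult_indicator ennreal_mult)
  finally show ?thesis using inverse_powr_times(1) \<tau>(1) by simp
qed

lemma energy_second:
  "(\<integral>\<^sup>+t\<in>{\<tau>..<d b}. ennreal (opt_speed t powr \<alpha>) \<partial>lborel) = ennreal ((d b - \<tau>) powr (1 - \<alpha>))"
proof -
  have "(\<integral>\<^sup>+t\<in>{\<tau>..<d b}. ennreal (opt_speed t powr \<alpha>) \<partial>lborel)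
      = (\<integral>\<^sup>+t. ennreal ((1 / (d b - \<tau>)) powr \<alpha>) * indicator {\<tau>..<d b} t \<partial>lborel)"
    by (intro nn_integral_cong) (auto simp: opt_speed_def indicator_def)
  also have "\<dots> = ennreal ((1 / (d b - \<tau>)) powr \<alpha> * (d b - \<tau>))"
    using \<tau> by (simp add: nn_integral_cmult_indicator ennreal_mult)
  finally show ?thesis using inverse_powr_times(1)[of "d b - \<tau>"] \<tau>(4) by simp
qed

lemma energy_total: "(\<integral>\<^sup>+t. ennreal (opt_speed t powr \<alpha>) \<partial>lborel) = ennreal opt_energy"
proof -
  have "(\<integral>\<^sup>+t. ennreal (opt_speed t powr \<alpha>) \<partial>lborel)
      = (\<integral>\<^sup>+t. ennreal (opt_speed t powr \<alpha>) * indicator {0..<\<tau>} t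
            + ennreal (opt_speed t powr \<alpha>) * indicator {\<tau>..<d b} t \<partial>lborel)"
    by (intro nn_integral_cong) (auto simp: opt_speed_def indicator_def)
  also have "\<dots> = ennreal (\<tau> powr (1 - \<alpha>)) + ennreal ((d b - \<tau>) powr (1 - \<alpha>))"
    by (subst nn_integral_add) (auto simp: energy_first energy_second)
  finally show ?thesis by (simp add: opt_energy_def ennreal_plus)
qed

lemma energy_opt_schedule: "energy \<alpha> opt_schedule UNIV = ennreal opt_energy"
  using energy_total by (simp add: energy_def opt_schedule_def)

section \<open>Optimality and almost-everywhere uniqueness of the speed\<close>

text \<open>The left-hand side pairs the speed of \<open>S\<close> with the gradient of the energy at the optimum.\<close>

lemma gradient_bound:
  assumes "feasible 2 (\<lambda>_. 1) (\<lambda>_. 0) d S"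
  shows "ennreal opt_energy
    \<le> (\<integral>\<^sup>+t. ennreal (opt_speed t powr (\<alpha> - 1) * speed S t) \<partial>lborel)"
proof -
  let ?A = "{0..d a} \<inter> {t. job S t = Some a}"
  let ?B = "{0..d b} \<inter> {t. job S t = Some b}"
  let ?k = "ennreal (\<tau> powr (1 - \<alpha>))" and ?l = "ennreal ((d b - \<tau>) powr (1 - \<alpha>))"
  have [measurable]: "speed S \<in> borel_measurable borel" "job S \<in> measurable borel (count_space UNIV)"
    and pos: "\<And>t. 0 \<le> speed S t"
    and wl: "workload S a {0..d a} = 1" "workload S b {0..d b} = 1"
    using assms ab by (auto simp: feasible_def schedule_for_def)
  have key: "ennreal (speed S t) * indicator ?A t * ?k + ennreal (speed S t) * indicator ?B t * ?l
      \<le> ennreal (opt_speed t powr (\<alpha> - 1) * speed S t)"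
    \<comment> \<open>At these two instants the closed windows may still allow a job although
      \<open>opt_speed\<close> has already dropped; they form a null set.\<close>
    if t: "t \<noteq> \<tau>" "t \<noteq> d b" for t
  proof -
    have a: "\<tau> powr (1 - \<alpha>) \<le> opt_speed t powr (\<alpha> - 1)" if "0 \<le> t" "t \<le> d a"
    proof -
      \<comment> \<open>Either the window of \<open>a\<close> ends at \<tau>, or the optimal speed
        is the same on both pieces.\<close>
      have "\<tau> = d a \<or> d b - \<tau> = \<tau>" using \<tau>(5) by auto
      then have "opt_speed t = 1 / \<tau>" using that t first by (auto simp: opt_speed_def)
      then show ?thesis using inverse_powr_times(2)[OF \<tau>(1)] by simp
    qed
    have b: "(d b - \<tau>) powr (1 - \<alpha>) \<le> opt_speed t powr (\<alpha> - 1)" if "0 \<le> t" "t \<le> d b"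
    proof -
      have "1 / (d b - \<tau>) \<le> opt_speed t"
        using that t \<tau> by (auto simp: opt_speed_def intro!: divide_left_mono)
      then have "(1 / (d b - \<tau>)) powr (\<alpha> - 1) \<le> opt_speed t powr (\<alpha> - 1)"
        using \<tau> exponent by (intro powr_mono2) auto
      then show ?thesis using inverse_powr_times(2)[of "d b - \<tau>"] \<tau> by simp
    qed
    show ?thesis
      using a b pos[of t] ab(3) jobs(2)
      by (auto simp: indicator_def ennreal_mult[symmetric] mult.commute
          intro!: ennreal_leI mult_left_mono)
  qed
  have "ennreal opt_energy = workload S a {0..d a} * ?k + workload S b {0..d b} * ?l"
    by (simp add: wl opt_energy_def ennreal_plus)
  also have "\<dots> = (\<integral>\<^sup>+t. ennreal (speed S t) * indicator ?A t * ?k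
      + ennreal (speed S t) * indicator ?B t * ?l \<partial>lborel)"
    unfolding workload_def
    by (subst nn_integral_add) (auto simp: nn_integral_multc)
  also have "\<dots> \<le> (\<integral>\<^sup>+t. ennreal (opt_speed t powr (\<alpha> - 1) * speed S t) \<partial>lborel)"
    using AE_lborel_singleton[of \<tau>] AE_lborel_singleton[of "d b"] key
    by (intro nn_integral_mono_AE) auto
  finally show ?thesis .
qed

text \<open>Integrating the tangent inequality at \<open>opt_speed\<close>, with slack
  \<open>gap\<close>, and applying \<open>gradient_bound\<close> shows that the excess energy of
  \<open>S\<close> is at least the integral of \<open>gap\<close>. Without excess,
  \<open>gap\<close> vanishes almost everywhere, and strictness identifies the speeds.\<close>

lemma energy_lower_bound:
  assumes "feasible 2 (\<lambda>_. 1) (\<lambda>_. 0) d S"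
  shows "ennreal opt_energy \<le> energy \<alpha> S UNIV"
    and "energy \<alpha> S UNIV \<le> ennreal opt_energy \<Longrightarrow> AE t in lborel. speed S t = opt_speed t"
proof -
  have [measurable]: "speed S \<in> borel_measurable borel" and pos: "\<And>t. 0 \<le> speed S t"
    using assms by (auto simp: feasible_def schedule_for_def)
  define gap where "gap t = speed S t powr \<alpha> + (\<alpha> - 1) * opt_speed t powr \<alpha>
      - \<alpha> * (opt_speed t powr (\<alpha> - 1) * speed S t)" for t
  have [measurable]: "gap \<in> borel_measurable borel" unfolding gap_def[abs_def] by measurable
  have gap_nonneg: "0 \<le> gap t" for t
    using powr_tangent[OF exponent pos opt_speed_nonneg, of t t]
    by (simp add: gap_def algebra_simps)
  have gap_zero: "speed S t = opt_speed t" if "gap t = 0" for t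
    using powr_tangent_strict[OF exponent pos opt_speed_nonneg, of t t] that
    by (force simp: gap_def algebra_simps)
  let ?G = "\<integral>\<^sup>+t. ennreal (opt_speed t powr (\<alpha> - 1) * speed S t) \<partial>lborel"
  let ?E = "ennreal opt_energy"
  have "energy \<alpha> S UNIV + ennreal (\<alpha> - 1) * ?E
      = (\<integral>\<^sup>+t. ennreal (speed S t powr \<alpha>) + ennreal (\<alpha> - 1) * ennreal (opt_speed t powr \<alpha>) \<partial>lborel)"
    unfolding energy_total[symmetric]
    by (subst nn_integral_add) (auto simp: nn_integral_cmult energy_def)
  also have "\<dots> = (\<integral>\<^sup>+t. ennreal \<alpha> * ennreal (opt_speed t powr (\<alpha> - 1) * speed S t)
      + ennreal (gap t) \<partial>lborel)"
    using exponent pos gap_nonneg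
    by (intro nn_integral_cong)
      (simp add: ennreal_mult[symmetric] ennreal_plus[symmetric] gap_def del: ennreal_plus)
  also have "\<dots> = ennreal \<alpha> * ?G + (\<integral>\<^sup>+t. ennreal (gap t) \<partial>lborel)"
    by (subst nn_integral_add) (auto simp: nn_integral_cmult)
  also have "\<dots> \<ge> ennreal \<alpha> * ?E + (\<integral>\<^sup>+t. ennreal (gap t) \<partial>lborel)"
    by (intro add_right_mono mult_left_mono gradient_bound assms) auto
  finally have "ennreal \<alpha> * ?E + (\<integral>\<^sup>+t. ennreal (gap t) \<partial>lborel)
      \<le> energy \<alpha> S UNIV + ennreal (\<alpha> - 1) * ?E" .
  moreover have "ennreal \<alpha> * ?E = ennreal (\<alpha> - 1) * ?E + ?E"
  proof -
    have "ennreal \<alpha> = ennreal (\<alpha> - 1) + 1"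
      using exponent ennreal_plus[of "\<alpha> - 1" 1] by simp
    then show ?thesis by (simp add: distrib_right)
  qed
  ultimately have "ennreal (\<alpha> - 1) * ?E + (?E + (\<integral>\<^sup>+t. ennreal (gap t) \<partial>lborel))
      \<le> ennreal (\<alpha> - 1) * ?E + energy \<alpha> S UNIV"
    by (simp add: ac_simps)
  then have main: "?E + (\<integral>\<^sup>+t. ennreal (gap t) \<partial>lborel) \<le> energy \<alpha> S UNIV"
    \<comment> \<open>Cancellation in \<open>ennreal\<close> is legitimate because the cancelled
      term is finite.\<close>
    by (subst (asm) ennreal_add_left_cancel_le) (auto simp: ennreal_mult_eq_top_iff)
  then show "?E \<le> energy \<alpha> S UNIV"
    by (meson add_increasing2 dual_order.trans order_refl zero_le add_left_mono le_iff_add)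
  assume "energy \<alpha> S UNIV \<le> ?E"
  with main have "?E + (\<integral>\<^sup>+t. ennreal (gap t) \<partial>lborel) \<le> ?E"
    by (rule order_trans)
  then have "(\<integral>\<^sup>+t. ennreal (gap t) \<partial>lborel) = 0"
    by simp
  then have "AE t in lborel. ennreal (gap t) = 0"
    by (subst (asm) nn_integral_0_iff_AE) auto
  then show "AE t in lborel. speed S t = opt_speed t"
    using gap_nonneg gap_zero by (auto elim!: eventually_mono simp: ennreal_eq_0_iff order.antisym)
qed

section \<open>Feasibility and EDF order of the candidate\<close>

lemma workload_opt_schedule:
  "workload opt_schedule a T = (\<integral>\<^sup>+t\<in>T \<inter> {0..<\<tau>}. ennreal (opt_speed t) \<partial>lborel)"
  "workload opt_schedule b T = (\<integral>\<^sup>+t\<in>T \<inter> {\<tau>..<d b}. ennreal (opt_speed t) \<partial>lborel)"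
proof -
  have "{t. opt_job t = Some a} = {0..<\<tau>}" "{t. opt_job t = Some b} = {\<tau>..<d b}"
    using ab \<tau> by (auto simp: opt_job_def split: if_splits)
  then show "workload opt_schedule a T = (\<integral>\<^sup>+t\<in>T \<inter> {0..<\<tau>}. ennreal (opt_speed t) \<partial>lborel)"
    "workload opt_schedule b T = (\<integral>\<^sup>+t\<in>T \<inter> {\<tau>..<d b}. ennreal (opt_speed t) \<partial>lborel)"
    by (simp_all add: workload_def opt_schedule_def)
qed

lemma feasible_opt_schedule: "feasible 2 (\<lambda>_. 1) (\<lambda>_. 0) d opt_schedule"
proof -
  have "{0..d a} \<inter> {0..<\<tau>} = {0..<\<tau>}" "{0..d b} \<inter> {\<tau>..<d b} = {\<tau>..<d b}"
    using \<tau> by auto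
  then have "workload opt_schedule a UNIV = 1" "workload opt_schedule a {0..d a} = 1"
    "workload opt_schedule b UNIV = 1" "workload opt_schedule b {0..d b} = 1"
    using \<tau> by (simp_all add: workload_opt_schedule integral_opt_speed_first integral_opt_speed_second)
  then show ?thesis
    using ab opt_speed_nonneg
    by (auto simp: feasible_def schedule_for_def less_two_iff opt_schedule_def opt_job_def
        split: if_splits)
qed

lemma edf_iff:
  "edf 2 (\<lambda>_. 1) (\<lambda>_. 0) d S \<longleftrightarrow>
    (\<forall>t. (job S t = Some a \<longleftrightarrow> 0 \<le> t \<and> workload S a {..t} < 1) \<and>
         (job S t = Some b \<longleftrightarrow> 0 \<le> t \<and> workload S b {..t} < 1 \<and> \<not> workload S a {..t} < 1) \<and>
         (\<forall>i. job S t = Some i \<longrightarrow> i = a \<or> i = b))"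
  (is "?L \<longleftrightarrow> ?R")
proof -
  have pend: "i \<in> pending 2 (\<lambda>_. 1) (\<lambda>_. 0) S t \<longleftrightarrow>
      (i = a \<or> i = b) \<and> 0 \<le> t \<and> workload S i {..t} < 1" for i t
    by (auto simp: pending_def less_two_iff)
  have "(i \<in> pending 2 (\<lambda>_. 1) (\<lambda>_. 0) S t \<and>
        (\<forall>j \<in> pending 2 (\<lambda>_. 1) (\<lambda>_. 0) S t. d i < d j \<or> d i = d j \<and> i \<le> j)) \<longleftrightarrow>
      (i = a \<and> 0 \<le> t \<and> workload S a {..t} < 1) \<or>
      (i = b \<and> 0 \<le> t \<and> workload S b {..t} < 1 \<and> \<not> workload S a {..t} < 1)" for i t
    using first ab(3) unfolding Ball_def pend by fastforce
  then have "?L \<longleftrightarrow> (\<forall>t i. job S t = Some i \<longleftrightarrow>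
      (i = a \<and> 0 \<le> t \<and> workload S a {..t} < 1) \<or>
      (i = b \<and> 0 \<le> t \<and> workload S b {..t} < 1 \<and> \<not> workload S a {..t} < 1))"
    unfolding edf_def by simp
  also have "\<dots> \<longleftrightarrow> ?R"
    by (simp only: eq_Some_iff_two[OF ab(3)])
  finally show ?thesis .
qed

lemma edf_opt_schedule: "edf 2 (\<lambda>_. 1) (\<lambda>_. 0) d opt_schedule"
proof -
  have wa: "workload opt_schedule a {..t} < 1 \<longleftrightarrow> t < \<tau>" if "0 \<le> t" for t
  proof (cases "t < \<tau>")
    case True
    \<comment> \<open>The midpoint gives a half-open interval that contains the work done up to
      \<open>t\<close> but ends before \<tau>, hence a bound strictly below 1.\<close>
    have "workload opt_schedule a {..t} \<le> (\<integral>\<^sup>+u\<in>{0..<(t + \<tau>) / 2}. ennreal (opt_speed u) \<partial>lborel)"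
      unfolding workload_opt_schedule using True
      by (intro nn_integral_mono) (auto simp: indicator_def)
    also have "\<dots> = ennreal ((t + \<tau>) / 2 / \<tau>)"
      using True that by (intro integral_opt_speed_first) auto
    also have "\<dots> < 1" using True \<tau>(1) that by (simp add: field_simps)
    finally show ?thesis using True by simp
  next
    case False
    then have "{..t} \<inter> {0..<\<tau>} = {0..<\<tau>}" by auto
    then have "workload opt_schedule a {..t} = 1"
      using \<tau> by (simp add: workload_opt_schedule integral_opt_speed_first)
    with False show ?thesis by simp
  qed
  have wb: "workload opt_schedule b {..t} < 1 \<longleftrightarrow> t < d b" if "\<tau> \<le> t" for t
  proof (cases "t < d b")
    case True
    have "workload opt_schedule b {..t} \<le> (\<integral>\<^sup>+u\<in>{\<tau>..<(t + d b) / 2}. ennreal (opt_speed u) \<partial>lborel)"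
      unfolding workload_opt_schedule using True
      by (intro nn_integral_mono) (auto simp: indicator_def)
    also have "\<dots> = ennreal (((t + d b) / 2 - \<tau>) / (d b - \<tau>))"
      using True that by (intro integral_opt_speed_second) auto
    also have "\<dots> < 1" using True \<tau> that by (simp add: field_simps)
    finally show ?thesis using True by simp
  next
    case False
    then have "{..t} \<inter> {\<tau>..<d b} = {\<tau>..<d b}" by auto
    then have "workload opt_schedule b {..t} = 1"
      using \<tau> by (simp add: workload_opt_schedule integral_opt_speed_second)
    with False show ?thesis by simp
  qed
  show ?thesis
    unfolding edf_iff using ab(3) wa wb \<tau>(1,4)
    by (auto simp: opt_schedule_def opt_job_def split: if_splits)
qed

section \<open>Cost shares of an arbitrary optimal schedule\<close>

lemma is_OPT_opt_schedule: "is_OPT \<alpha> 2 (\<lambda>_. 1) (\<lambda>_. 0) d opt_schedule"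
  using feasible_opt_schedule edf_opt_schedule energy_lower_bound(1)
  by (auto simp: is_OPT_def energy_opt_schedule)

text \<open>\<open>OPT\<close> is a mere choice, so every optimal schedule must be treated. Its
  speed is known almost everywhere, and EDF then fixes the jobs: \<open>a\<close> runs from 0 until
  it has unit work, which happens at \<tau>, and \<open>b\<close> follows.\<close>

lemma is_OPT_energy:
  assumes opt: "is_OPT \<alpha> 2 (\<lambda>_. 1) (\<lambda>_. 0) d S"
  shows "energy \<alpha> S {t. job S t = Some a} = ennreal (\<tau> powr (1 - \<alpha>))"
    and "energy \<alpha> S {t. job S t = Some b} = ennreal ((d b - \<tau>) powr (1 - \<alpha>))"
proof -
  have feas: "feasible 2 (\<lambda>_. 1) (\<lambda>_. 0) d S" and edf: "edf 2 (\<lambda>_. 1) (\<lambda>_. 0) d S"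
    and "energy \<alpha> S UNIV \<le> ennreal opt_energy"
    using opt feasible_opt_schedule by (auto simp: is_OPT_def simp flip: energy_opt_schedule)
  then have ae: "AE t in lborel. speed S t = opt_speed t"
    by (intro energy_lower_bound(2))
  have wl: "workload S i T = (\<integral>\<^sup>+t\<in>T \<inter> {t. job S t = Some i}. ennreal (opt_speed t) \<partial>lborel)" for i T
    unfolding workload_def using ae by (intro nn_integral_cong_AE) auto
  have en: "energy \<alpha> S T = (\<integral>\<^sup>+t\<in>T. ennreal (opt_speed t powr \<alpha>) \<partial>lborel)" for T
    unfolding energy_def using ae by (intro nn_integral_cong_AE) auto
  have job_a: "job S t = Some a \<longleftrightarrow> 0 \<le> t \<and> workload S a {..t} < 1"
    and job_b: "job S t = Some b \<longleftrightarrow> 0 \<le> t \<and> workload S b {..t} < 1 \<and> \<not> workload S a {..t} < 1" for t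
    using edf unfolding edf_iff by blast+
  have Ja: "job S t = Some a \<longleftrightarrow> t \<in> {0..<\<tau>}" for t
  proof
    assume t: "t \<in> {0..<\<tau>}"
    \<comment> \<open>Even if \<open>a\<close> had received all the work done so far, it would still
      be incomplete at \<open>t\<close>.\<close>
    have "workload S a {..t} \<le> (\<integral>\<^sup>+u\<in>{0..<(t + \<tau>) / 2}. ennreal (opt_speed u) \<partial>lborel)"
      unfolding wl using t job_a by (intro nn_integral_mono) (auto simp: indicator_def)
    also have "\<dots> = ennreal ((t + \<tau>) / 2 / \<tau>)"
      using t by (intro integral_opt_speed_first) auto
    also have "\<dots> < 1" using t \<tau>(1) by (simp add: field_simps)
    finally show "job S t = Some a" using t job_a by simp
  next
    assume j: "job S t = Some a"
    then have t: "0 \<le> t" "workload S a {..t} < 1" using job_a by auto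
    show "t \<in> {0..<\<tau>}"
    proof (rule ccontr)
      assume "t \<notin> {0..<\<tau>}"
      with t have "\<tau> \<le> t" by simp
      \<comment> \<open>Workload grows with time, so if \<open>a\<close> is incomplete at
        \<open>t\<close>, it was incomplete and hence processed throughout the first
        interval.\<close>
      have "job S u = Some a" if "0 \<le> u" "u < \<tau>" for u
        using job_a that t(2) mono_workload[of "{..u}" "{..t}" S a] \<open>\<tau> \<le> t\<close> by force
      then have "(\<integral>\<^sup>+u\<in>{0..<\<tau>}. ennreal (opt_speed u) \<partial>lborel) \<le> workload S a {..t}"
        unfolding wl using \<open>\<tau> \<le> t\<close> by (intro nn_integral_mono) (auto simp: indicator_def)
      with t(2) \<tau>(1) show False by (simp add: integral_opt_speed_first)
    qed
  qed
  have Jb_ge: "\<tau> \<le> t" if "job S t = Some b" for t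
    using that job_b[of t] job_a[of t] Ja[of t] by auto
  have Jb: "job S t = Some b" if t: "\<tau> \<le> t" "t < d b" for t
  proof -
    have "workload S b {..t} \<le> (\<integral>\<^sup>+u\<in>{\<tau>..<(t + d b) / 2}. ennreal (opt_speed u) \<partial>lborel)"
      unfolding wl using t Jb_ge by (intro nn_integral_mono) (auto simp: indicator_def)
    also have "\<dots> = ennreal (((t + d b) / 2 - \<tau>) / (d b - \<tau>))"
      using t by (intro integral_opt_speed_second) auto
    also have "\<dots> < 1" using t \<tau> by (simp add: field_simps)
    finally have "workload S b {..t} < 1" .
    then show ?thesis
      using job_b[of t] job_a[of t] Ja[of t] t \<tau>(1) by auto
  qed
  have "{t. job S t = Some a} = {0..<\<tau>}" using Ja by blast
  then show "energy \<alpha> S {t. job S t = Some a} = ennreal (\<tau> powr (1 - \<alpha>))"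
    by (simp add: en energy_first)
  \<comment> \<open>Whether \<open>b\<close> is assigned from \<open>d b\<close> on makes no
    difference, since \<open>opt_speed\<close> is 0 there.\<close>
  have "energy \<alpha> S {t. job S t = Some b} = energy \<alpha> S {\<tau>..<d b}"
    unfolding en using Jb Jb_ge exponent
    by (intro nn_integral_cong) (auto simp: indicator_def opt_speed_def dest: Jb_ge)
  then show "energy \<alpha> S {t. job S t = Some b} = ennreal ((d b - \<tau>) powr (1 - \<alpha>))"
    by (simp add: en energy_second)
qed

lemma prop_share:
  "prop_share \<alpha> 2 (\<lambda>_. 1) (\<lambda>_. 0) d a = \<tau> powr (1 - \<alpha>)"
  "prop_share \<alpha> 2 (\<lambda>_. 1) (\<lambda>_. 0) d b = (d b - \<tau>) powr (1 - \<alpha>)"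
proof -
  have "is_OPT \<alpha> 2 (\<lambda>_. 1) (\<lambda>_. 0) d (OPT \<alpha> 2 (\<lambda>_. 1) (\<lambda>_. 0) d)"
    unfolding OPT_def using is_OPT_opt_schedule by (rule someI)
  then show "prop_share \<alpha> 2 (\<lambda>_. 1) (\<lambda>_. 0) d a = \<tau> powr (1 - \<alpha>)"
    "prop_share \<alpha> 2 (\<lambda>_. 1) (\<lambda>_. 0) d b = (d b - \<tau>) powr (1 - \<alpha>)"
    by (simp_all add: prop_share_def Let_def is_OPT_energy)
qed

end

section \<open>The two-player game\<close>

text \<open>Share of the player announcing \<open>x\<close> against \<open>y\<close>. At a tie of
  positive deadlines both branches equal \<open>(x / 2) powr (1 - \<alpha>)\<close>, so the
  tie-break by index disappears and the game is symmetric.\<close>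

definition share_two :: "real \<Rightarrow> real \<Rightarrow> real \<Rightarrow> real" where
  "share_two \<alpha> x y =
    (if x \<le> y then min x (y / 2) powr (1 - \<alpha>) else (x - min y (x / 2)) powr (1 - \<alpha>))"

text \<open>The opponent of \<open>i\<close> is \<open>1 - i\<close>; the two EDF orders instantiate
  \<open>two_jobs\<close> with \<open>i\<close> as first or as second job.\<close>

lemma prop_share_two:
  assumes "1 < \<alpha>" "i < 2" "0 < d i" "0 < d (1 - i)"
  shows "prop_share \<alpha> 2 (\<lambda>_. 1) (\<lambda>_. 0) d i = share_two \<alpha> (d i) (d (1 - i))"
proof -
  have i: "i = 0 \<or> i = 1" using assms(2) by auto
  consider "d i < d (1 - i) \<or> d i = d (1 - i) \<and> i < 1 - i"
    | "d (1 - i) < d i \<or> d i = d (1 - i) \<and> 1 - i < i"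
    using i by fastforce
  then show ?thesis
  proof cases
    case 1
    interpret two_jobs \<alpha> i "1 - i" d
      using assms i 1 by unfold_locales auto
    show ?thesis using 1 prop_share(1)[unfolded \<tau>_def] by (auto simp: share_two_def)
  next
    case 2
    interpret two_jobs \<alpha> "1 - i" i d
      using assms i 2 by unfold_locales auto
    show ?thesis using 2 prop_share(2)[unfolded \<tau>_def] assms by (auto simp: share_two_def min_def)
  qed
qed

text \<open>The weight \<open>\<alpha> - 1\<close> normalises the game: a player alone on an
  interval of length \<open>u\<close> has marginal penalty
  \<open>(\<alpha> - 1) * (1 - u powr (- \<alpha>))\<close>, which vanishes exactly at
  \<open>u = 1\<close>.\<close>

lemma no_equilibrium_two:
  fixes \<alpha> x y :: real
  assumes \<alpha>: "1 < \<alpha>" and pos: "0 < x" and le: "x \<le> y"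
    and x_opt: "\<And>z. 0 < z \<Longrightarrow> (\<alpha> - 1) * x + share_two \<alpha> x y \<le> (\<alpha> - 1) * z + share_two \<alpha> z y"
    and y_opt: "\<And>z. 0 < z \<Longrightarrow> (\<alpha> - 1) * y + share_two \<alpha> y x \<le> (\<alpha> - 1) * z + share_two \<alpha> z x"
  shows False
proof -
  \<comment> \<open>Here \<open>c\<close> is the start of the player's own interval:
    \<open>x\<close> for the second player, 0 for the first.\<close>
  have shift: "((\<lambda>z. (\<alpha> - 1) * z + (z - c) powr (1 - \<alpha>)) has_real_derivative
      (\<alpha> - 1) * (1 - (u - c) powr (- \<alpha>))) (at u)" if "c < u" for c u
    using that by (auto intro!: derivative_eq_intros simp: algebra_simps)
  have one: "u = 1" if "0 < u" "u powr (- \<alpha>) = 1" for u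
    using powr_eq_one_iff_gen[of u "- \<alpha>"] that \<alpha> by auto
  have "\<not> y / 2 < x"
  proof
    assume "y / 2 < x"
    then have "share_two \<alpha> (y / 2) y = share_two \<alpha> x y"
      using pos le by (simp add: share_two_def)
    moreover have "(\<alpha> - 1) * (y / 2) < (\<alpha> - 1) * x"
      using \<alpha> \<open>y / 2 < x\<close> by simp
    ultimately show False using x_opt[of "y / 2"] pos le by linarith
  qed
  then have "2 * x \<le> y" by simp
  then consider "2 * x < y" | "y = 2 * x" by linarith
  then show False
  proof cases
    case 1
    \<comment> \<open>The radius keeps \<open>2 * x < z\<close>, so the first job still ends at
      \<open>x\<close>.\<close>
    have sy: "share_two \<alpha> z x = (z - x) powr (1 - \<alpha>)" if "\<bar>y - z\<bar> < y - 2 * x" for z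
      using that pos by (auto simp: share_two_def min_def)
    have "(\<alpha> - 1) * (1 - (y - x) powr (- \<alpha>)) = 0"
    proof (rule DERIV_local_min[OF shift, of x y])
      show "\<forall>z. \<bar>y - z\<bar> < y - 2 * x \<longrightarrow>
          (\<alpha> - 1) * y + (y - x) powr (1 - \<alpha>) \<le> (\<alpha> - 1) * z + (z - x) powr (1 - \<alpha>)"
      proof (intro allI impI)
        fix z assume z: "\<bar>y - z\<bar> < y - 2 * x"
        show "(\<alpha> - 1) * y + (y - x) powr (1 - \<alpha>) \<le> (\<alpha> - 1) * z + (z - x) powr (1 - \<alpha>)"
          using y_opt[of z] sy[OF z] sy[of y] z 1 pos by auto
      qed
    qed (use 1 pos in auto)
    then have "(y - x) powr (- \<alpha>) = 1" using \<alpha> by auto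
    then have "y - x = 1" using one[of "y - x"] 1 pos by simp
    have sx: "share_two \<alpha> z y = z powr (1 - \<alpha>)" if "\<bar>x - z\<bar> < y / 2 - x" for z
      using that 1 pos by (auto simp: share_two_def min_def)
    have "(\<alpha> - 1) * (1 - (x - 0) powr (- \<alpha>)) = 0"
    proof (rule DERIV_local_min[OF shift, of 0 x])
      \<comment> \<open>The first bound keeps \<open>z\<close> positive, the second keeps
        \<open>2 * z < y\<close>.\<close>
      show "0 < min x (y / 2 - x)" using 1 pos by simp
      show "\<forall>z. \<bar>x - z\<bar> < min x (y / 2 - x) \<longrightarrow>
          (\<alpha> - 1) * x + (x - 0) powr (1 - \<alpha>) \<le> (\<alpha> - 1) * z + (z - 0) powr (1 - \<alpha>)"
      proof (intro allI impI)
        fix z assume z: "\<bar>x - z\<bar> < min x (y / 2 - x)"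
        show "(\<alpha> - 1) * x + (x - 0) powr (1 - \<alpha>) \<le> (\<alpha> - 1) * z + (z - 0) powr (1 - \<alpha>)"
          using x_opt[of z] sx[of z] sx[of x] z 1 pos by auto
      qed
    qed (use pos in auto)
    then have "x powr (- \<alpha>) = 1" using \<alpha> by auto
    then have "x = 1" by (rule one[OF pos])
    with \<open>y - x = 1\<close> 1 show False by simp
  next
    case 2
    have sx: "share_two \<alpha> z x = (z - x) powr (1 - \<alpha>)" if "y \<le> z" for z
      using that pos 2 by (auto simp: share_two_def min_def)
    have sl: "share_two \<alpha> z x = (z / 2) powr (1 - \<alpha>)" if "x < z" "z \<le> y" for z
      using that 2 by (simp add: share_two_def min_absorb2)
    \<comment> \<open>A later deadline only lengthens the second player's own interval, now of
      length \<open>x\<close>; were it shorter than 1, a small postponement would pay.\<close>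
    have "1 \<le> x"
    proof (rule ccontr)
      assume "\<not> 1 \<le> x"
      then have "1 powr (- \<alpha>) < x powr (- \<alpha>)"
        using \<alpha> pos by (intro powr_less_mono2_neg) auto
      then have "(\<alpha> - 1) * (1 - (y - x) powr (- \<alpha>)) < 0"
        using \<alpha> 2 by (intro mult_pos_neg) auto
      then obtain h where h: "0 < h" "\<And>k. \<lbrakk>0 < k; k < h\<rbrakk> \<Longrightarrow>
          (\<alpha> - 1) * (y + k) + (y + k - x) powr (1 - \<alpha>) < (\<alpha> - 1) * y + (y - x) powr (1 - \<alpha>)"
        using DERIV_neg_dec_right[OF shift, of x y] pos 2 by auto
      have "0 < h / 2" "h / 2 < h" using h(1) by auto
      from h(2)[OF this] show False
        using y_opt[of "y + h / 2"] sx[of y] sx[of "y + h / 2"] h(1) pos 2 by linarith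
    qed
    then have "x powr (- \<alpha>) \<le> 1 powr (- \<alpha>)"
      using \<alpha> by (intro powr_mono2') auto
    \<comment> \<open>To the left of \<open>y\<close> the jobs split the time equally. The chain
      rule halves the energy term, which is at most 1, so the left slope is positive and a slightly
      earlier deadline pays.\<close>
    then have "0 < (\<alpha> - 1) * (1 - (y / 2) powr (- \<alpha>) / 2)"
      using \<alpha> 2 by (intro mult_pos_pos) auto
    moreover have "((\<lambda>z. (\<alpha> - 1) * z + (z / 2) powr (1 - \<alpha>)) has_real_derivative
        (\<alpha> - 1) * (1 - (y / 2) powr (- \<alpha>) / 2)) (at y)"
      using pos 2 by (auto intro!: derivative_eq_intros simp: field_simps)
    ultimately obtain h where h: "0 < h" "\<And>k. \<lbrakk>0 < k; k < h\<rbrakk> \<Longrightarrow>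
        (\<alpha> - 1) * (y - k) + ((y - k) / 2) powr (1 - \<alpha>) < (\<alpha> - 1) * y + (y / 2) powr (1 - \<alpha>)"
      using DERIV_pos_inc_left[of "\<lambda>z. (\<alpha> - 1) * z + (z / 2) powr (1 - \<alpha>)"] by blast
    \<comment> \<open>Below \<open>h\<close> for the derivative bound, and below \<open>x\<close> so
      that the deviating player stays second.\<close>
    define k where "k = min (h / 2) (x / 2)"
    have k: "0 < k" "k < h" "k < x" using h(1) pos by (auto simp: k_def)
    show False
      using h(2)[OF k(1,2)] y_opt[of "y - k"] sl[of y] sl[of "y - k"] k pos 2 by linarith
  qed
qed

theorem theorem1:
  fixes \<alpha> :: real
  assumes "2 \<le> \<alpha>" and "\<alpha> \<le> 3"
  shows "\<exists>(n::nat) (w :: nat \<Rightarrow> real) (r :: nat \<Rightarrow> real) (p :: nat \<Rightarrow> real).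
           (\<forall>i<n. 0 < w i \<and> 0 < p i) \<and>
           (\<nexists>d :: nat \<Rightarrow> real. pure_Nash \<alpha> n w r p d)"
proof (intro exI conjI)
  have \<alpha>: "1 < \<alpha>" using assms by simp
  show "\<forall>i<2. 0 < (\<lambda>_. 1 :: real) i \<and> 0 < (\<lambda>_. \<alpha> - 1) i" using \<alpha> by simp
  show "\<nexists>d. pure_Nash \<alpha> 2 (\<lambda>_. 1) (\<lambda>_. 0) (\<lambda>_. \<alpha> - 1) d"
  proof
    assume "\<exists>d. pure_Nash \<alpha> 2 (\<lambda>_. 1) (\<lambda>_. 0) (\<lambda>_. \<alpha> - 1) d"
    then obtain d where nash: "pure_Nash \<alpha> 2 (\<lambda>_. 1) (\<lambda>_. 0) (\<lambda>_. \<alpha> - 1) d" ..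
    then have pos: "0 < d i" if "i < 2" for i using that by (auto simp: pure_Nash_def)
    have other: "1 - i < 2" "1 - i \<noteq> i" if "i < 2" for i :: nat
      using that by presburger+
    have opt: "(\<alpha> - 1) * d i + share_two \<alpha> (d i) (d (1 - i))
        \<le> (\<alpha> - 1) * z + share_two \<alpha> z (d (1 - i))" if "i < 2" "0 < z" for i z
      using nash that pos other[OF that(1)]
        prop_share_two[OF \<alpha>, of i d] prop_share_two[OF \<alpha>, of i "d(i := z)"]
      by (fastforce simp: pure_Nash_def penalty_def not_less)
    \<comment> \<open>By symmetry, the player with the smaller deadline takes the role of
      \<open>x\<close>.\<close>
    show False
    proof (cases "d 0 \<le> d 1")
      case True
      show False
        using no_equilibrium_two[OF \<alpha> _ True] pos[of 0] opt[of 0] opt[of 1] by simp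
    next
      case False
      show False
        using no_equilibrium_two[OF \<alpha>, of "d 1" "d 0"] False pos[of 1] opt[of 0] opt[of 1] by simp
    qed
  qed
qed

end
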